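(* Let $G$ be a connected graph, let $X\subseteq V(G)$ be a twin cover of $G$, and let $\varphi$ be a proper coloring of $G[X]$. Then the minimum number of colors used by a proper coloring of $G$ whose restriction to $X$ equals $\varphi$ is exactly \[ K_\varphi=\max_{S\subseteq X}\bigl(|\varphi(S)|+m(S)\bigr). \]
   Context: All graphs are finite, simple and undirected. Vertices $u\neq v$ are true twins if $N_G[u]=N_G[v]$; a twin edge is an edge whose endpoints are true twins; $X\subseteq V(G)$ is a twin cover of $G$ if every edge of $G-X$ is a twin edge. A twin-clique is a connected component of $G-X$; each twin-clique $C$ is a clique whose vertices all have the same neighborhood in $X$, denoted $N_X(C)$. For $S\subseteq X$, $m(S)$ is the maximum size $|C|$ of a twin-clique $C$ with $N_X(C)=S$, and $m(S)=0$ if no such twin-clique exists. $\varphi(S):=\{\varphi(x):x\in S\}$. *)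

theory Defs
  imports "Graph_Theory.Digraph_Component"
begin

text \<open>
  A finite simple undirected graph is modelled by the locale \<open>graph\<close>: a finite, loop-free,
  symmetric digraph without parallel arcs. An edge \<open>uv\<close> is the pair of arcs \<open>(u, v)\<close> and \<open>(v, u)\<close>.
\<close>

definition neighborhood :: "('a, 'b) pre_digraph \<Rightarrow> 'a \<Rightarrow> 'a set" where
  "neighborhood G u = {v. u \<rightarrow>\<^bsub>G\<^esub> v}"

definition closed_neighborhood :: "('a, 'b) pre_digraph \<Rightarrow> 'a \<Rightarrow> 'a set" where
  "closed_neighborhood G u = insert u (neighborhood G u)"

definition true_twins :: "('a, 'b) pre_digraph \<Rightarrow> 'a \<Rightarrow> 'a \<Rightarrow> bool" where
  "true_twins G u v \<longleftrightarrow>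
     u \<in> verts G \<and> v \<in> verts G \<and> u \<noteq> v \<and> closed_neighborhood G u = closed_neighborhood G v"

definition twin_edge :: "('a, 'b) pre_digraph \<Rightarrow> 'b \<Rightarrow> bool" where
  "twin_edge G e \<longleftrightarrow> e \<in> arcs G \<and> true_twins G (tail G e) (head G e)"

definition delete_verts :: "('a, 'b) pre_digraph \<Rightarrow> 'a set \<Rightarrow> ('a, 'b) pre_digraph" where
  "delete_verts G X = G \<restriction> (verts G - X)"

text \<open>The edges of \<open>G - X\<close> must be twin edges of \<open>G\<close>, not merely of \<open>G - X\<close>.\<close>

definition twin_cover :: "('a, 'b) pre_digraph \<Rightarrow> 'a set \<Rightarrow> bool" where
  "twin_cover G X \<longleftrightarrow> X \<subseteq> verts G \<and> (\<forall>e \<in> arcs (delete_verts G X). twin_edge G e)"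

text \<open>
  In a symmetric digraph the strongly connected components are the connected components;
  \<open>sccs_verts\<close> is the set of their vertex sets.
\<close>

definition twin_cliques :: "('a, 'b) pre_digraph \<Rightarrow> 'a set \<Rightarrow> 'a set set" where
  "twin_cliques G X = pre_digraph.sccs_verts (delete_verts G X)"

text \<open>
  \<open>N_X(C)\<close> as the union of the neighborhoods in \<open>X\<close> of the vertices of \<open>C\<close>. For a twin-clique these
  neighborhoods all coincide, see \<open>twin_clique_neighborhood\<close> below.
\<close>

definition neighborhood_in :: "('a, 'b) pre_digraph \<Rightarrow> 'a set \<Rightarrow> 'a set \<Rightarrow> 'a set" where
  "neighborhood_in G X C = (\<Union>u\<in>C. neighborhood G u \<inter> X)"

definition max_twin_clique :: "('a, 'b) pre_digraph \<Rightarrow> 'a set \<Rightarrow> 'a set \<Rightarrow> nat" where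
  "max_twin_clique G X S =
     (let \<C> = {C \<in> twin_cliques G X. neighborhood_in G X C = S}
      in if \<C> = {} then 0 else Max (card ` \<C>))"

text \<open>Colors are natural numbers. Only the values of a coloring on \<open>verts G\<close> are relevant.\<close>

definition proper_coloring :: "('a, 'b) pre_digraph \<Rightarrow> ('a \<Rightarrow> nat) \<Rightarrow> bool" where
  "proper_coloring G c \<longleftrightarrow> (\<forall>u v. u \<rightarrow>\<^bsub>G\<^esub> v \<longrightarrow> c u \<noteq> c v)"

definition extending_colorings ::
  "('a, 'b) pre_digraph \<Rightarrow> 'a set \<Rightarrow> ('a \<Rightarrow> nat) \<Rightarrow> ('a \<Rightarrow> nat) set" where
  "extending_colorings G X \<phi> = {c. proper_coloring G c \<and> (\<forall>x\<in>X. c x = \<phi> x)}"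

definition colors_used :: "('a, 'b) pre_digraph \<Rightarrow> ('a \<Rightarrow> nat) \<Rightarrow> nat" where
  "colors_used G c = card (c ` verts G)"

definition K_bound :: "('a, 'b) pre_digraph \<Rightarrow> 'a set \<Rightarrow> ('a \<Rightarrow> nat) \<Rightarrow> nat" where
  "K_bound G X \<phi> = Max {card (\<phi> ` S) + max_twin_clique G X S | S. S \<subseteq> X}"

definition is_minimum :: "'a::order \<Rightarrow> 'a set \<Rightarrow> bool" where
  "is_minimum m A \<longleftrightarrow> m \<in> A \<and> (\<forall>a\<in>A. m \<le> a)"

lemma twin_cover_neighborhood_eq:
  assumes "twin_cover G X" and uv: "u \<rightarrow>\<^bsub>delete_verts G X\<^esub> v"
  shows "neighborhood G u \<inter> X = neighborhood G v \<inter> X"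
proof -
  from uv obtain e where e: "e \<in> arcs (delete_verts G X)"
      "tail (delete_verts G X) e = u" "head (delete_verts G X) e = v"
    by (rule reachableE)
  then have te: "tail G e = u" "head G e = v" "u \<notin> X" "v \<notin> X"
    by (simp_all add: delete_verts_def)
  from assms(1) e(1) have "twin_edge G e"
    by (simp add: twin_cover_def)
  then have "closed_neighborhood G u = closed_neighborhood G v"
    by (simp add: twin_edge_def true_twins_def te)
  then have "insert u (neighborhood G u) \<inter> X = insert v (neighborhood G v) \<inter> X"
    by (simp add: closed_neighborhood_def)
  with te(3,4) show ?thesis
    by simp
qed

lemma twin_clique_neighborhood:
  assumes "twin_cover G X" and C: "C \<in> twin_cliques G X" and u: "u \<in> C"
  shows "neighborhood_in G X C = neighborhood G u \<inter> X"
proof -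
  have "neighborhood G v \<inter> X = neighborhood G u \<inter> X" if v: "v \<in> C" for v
  proof -
    have "u \<rightarrow>\<^sup>*\<^bsub>delete_verts G X\<^esub> v"
      using C u v by (simp add: twin_cliques_def pre_digraph.sccs_verts_def)
    then have "(u, v) \<in> (arcs_ends (delete_verts G X))\<^sup>*"
      by (rule reachable_rtranclI)
    then show ?thesis
    proof induction
      case (step y z)
      from step(3) show ?case
        by (simp only: twin_cover_neighborhood_eq[OF assms(1) step(2)])
    qed simp
  qed
  then have "neighborhood_in G X C = (\<Union>v\<in>C. neighborhood G u \<inter> X)"
    unfolding neighborhood_in_def by (rule SUP_cong[OF refl])
  with u show ?thesis by auto
qed

end

theory Submission
  imports Defs
begin

text \<open>
  The vertices of a twin-clique \<open>C\<close> are pairwise adjacent and all adjacent to \<open>N\<^sub>X(C)\<close>, so an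
  extension of \<open>\<phi>\<close> gives them \<open>|C|\<close> colors outside \<open>\<phi>(N\<^sub>X(C))\<close>. Conversely, fix any palette of
  \<open>K\<^sub>\<phi>\<close> colors that contains \<open>\<phi>(X)\<close>: outside \<open>\<phi>(N\<^sub>X(C))\<close> it has at least \<open>m(N\<^sub>X(C)) \<ge> |C|\<close> colors,
  and distinct twin-cliques are non-adjacent, so they can be colored independently of each other.
\<close>

lemma dominates_delete_verts_iff:
  assumes "wf_digraph G"
  shows "u \<rightarrow>\<^bsub>delete_verts G X\<^esub> v \<longleftrightarrow> u \<rightarrow>\<^bsub>G\<^esub> v \<and> u \<notin> X \<and> v \<notin> X"
proof -
  interpret wf_digraph G by fact
  show ?thesis
    by (auto simp: delete_verts_def arcs_ends_conv)
qed

lemma wf_digraph_delete_verts: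
  "wf_digraph G \<Longrightarrow> wf_digraph (delete_verts G X)"
  unfolding delete_verts_def by (rule wf_digraph.wellformed_induce_subgraph)

lemma verts_delete_verts [simp]: "verts (delete_verts G X) = verts G - X"
  by (simp add: delete_verts_def)

lemma twin_cliques_subset:
  assumes "wf_digraph G" "C \<in> twin_cliques G X"
  shows "C \<subseteq> verts G - X"
  using wf_digraph.sccs_verts_subsets[OF wf_digraph_delete_verts[OF assms(1)]] assms(2)
  by (auto simp: twin_cliques_def)

lemma twin_cliques_finite:
  assumes "fin_digraph G"
  shows "finite (twin_cliques G X)"
proof -
  interpret fin_digraph G by fact
  have "twin_cliques G X \<subseteq> Pow (verts G)"
    using twin_cliques_subset[OF wf_digraph_axioms] by blast
  then show ?thesis
    by (rule finite_subset) simp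
qed

text \<open>Every arc of \<open>G - X\<close> is a twin edge of \<open>G\<close>, so closed
  neighborhoods in \<open>G\<close> stay constant along a path in a component. Since
  \<open>v\<close> lies in its own closed neighborhood, it lies in that of \<open>u\<close>
  too.\<close>

lemma twin_clique_adjacent:
  assumes "twin_cover G X" and C: "C \<in> twin_cliques G X" "u \<in> C" "v \<in> C" and "u \<noteq> v"
  shows "u \<rightarrow>\<^bsub>G\<^esub> v"
proof -
  have "u \<rightarrow>\<^sup>*\<^bsub>delete_verts G X\<^esub> v"
    using C by (simp add: twin_cliques_def pre_digraph.sccs_verts_def)
  then have "(u, v) \<in> (arcs_ends (delete_verts G X))\<^sup>*"
    by (rule reachable_rtranclI)
  then have "closed_neighborhood G u = closed_neighborhood G v"
  proof induction
    case (step y z)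
    from step(2) obtain e where e: "e \<in> arcs (delete_verts G X)"
        "tail (delete_verts G X) e = y" "head (delete_verts G X) e = z"
      by (rule reachableE)
    then have "twin_edge G e"
      using assms(1) by (simp add: twin_cover_def)
    then have "closed_neighborhood G y = closed_neighborhood G z"
      using e by (simp add: twin_edge_def true_twins_def delete_verts_def)
    with step(3) show ?case by simp
  qed simp
  then have "v \<in> closed_neighborhood G u"
    by (simp add: closed_neighborhood_def)
  with \<open>u \<noteq> v\<close> show ?thesis
    by (simp add: closed_neighborhood_def neighborhood_def)
qed

lemma card_twin_clique_le_max_twin_clique:
  assumes "fin_digraph G" "C \<in> twin_cliques G X"
  shows "card C \<le> max_twin_clique G X (neighborhood_in G X C)"
proof -
  define \<C> where "\<C> = {D \<in> twin_cliques G X. neighborhood_in G X D = neighborhood_in G X C}"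
  have "finite \<C>" "C \<in> \<C>"
    using twin_cliques_finite[OF assms(1)] assms(2) by (auto simp: \<C>_def)
  then have "card C \<le> Max (card ` \<C>)" "\<C> \<noteq> {}"
    by auto
  then show ?thesis
    by (simp add: max_twin_clique_def flip: \<C>_def)
qed

text \<open>A case rule that trades the maximum for a witness: either the value is 0, as it is by
  default when no twin-clique has neighborhood \<open>S\<close>, or a largest such twin-clique
  realises it.\<close>

lemma max_twin_clique_attained:
  assumes "fin_digraph G"
  obtains "max_twin_clique G X S = 0"
    | C where "C \<in> twin_cliques G X" "neighborhood_in G X C = S" "max_twin_clique G X S = card C"
proof -
  define \<C> where "\<C> = {C \<in> twin_cliques G X. neighborhood_in G X C = S}"
  have eq: "max_twin_clique G X S = (if \<C> = {} then 0 else Max (card ` \<C>))"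
    by (simp only: max_twin_clique_def \<C>_def Let_def)
  show thesis
  proof (cases "\<C> = {}")
    case True
    with eq that(1) show thesis by simp
  next
    case False
    have "finite \<C>"
      using twin_cliques_finite[OF assms] by (simp add: \<C>_def)
    with False have "Max (card ` \<C>) \<in> card ` \<C>"
      by (intro Max_in) auto
    then obtain C where C: "C \<in> \<C>" "Max (card ` \<C>) = card C"
      by blast
    show thesis
    proof (rule that(2))
      show "C \<in> twin_cliques G X" "neighborhood_in G X C = S"
        using C(1) by (simp_all add: \<C>_def)
      show "max_twin_clique G X S = card C"
        using False eq C(2) by simp
    qed
  qed
qed

lemma K_bound_upper:
  assumes "finite X" "S \<subseteq> X"
  shows "card (\<phi> ` S) + max_twin_clique G X S \<le> K_bound G X \<phi>"
  unfolding K_bound_def using assms by (intro Max_ge) auto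

lemma K_bound_least:
  assumes "finite X" "\<And>S. S \<subseteq> X \<Longrightarrow> card (\<phi> ` S) + max_twin_clique G X S \<le> k"
  shows "K_bound G X \<phi> \<le> k"
  unfolding K_bound_def using assms by (subst Max_le_iff) auto

text \<open>Each \<open>S\<close> is treated separately, so a single twin-clique realising m(S)
  suffices to force the required number of colors.\<close>

lemma K_bound_le_colors_used:
  assumes "graph G" "twin_cover G X" "c \<in> extending_colorings G X \<phi>"
  shows "K_bound G X \<phi> \<le> colors_used G c"
proof -
  interpret graph G by fact
  have X: "X \<subseteq> verts G"
    using assms(2) by (simp add: twin_cover_def)
  have proper: "c u \<noteq> c v" if "u \<rightarrow>\<^bsub>G\<^esub> v" for u v
    using assms(3) that by (simp add: extending_colorings_def proper_coloring_def)
  have ext: "c ` S = \<phi> ` S" if "S \<subseteq> X" for S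
    using assms(3) that by (intro image_cong) (auto simp: extending_colorings_def)
  show ?thesis
  proof (rule K_bound_least)
    show "finite X"
      using X by (rule finite_subset) simp
    fix S assume S: "S \<subseteq> X"
    show "card (\<phi> ` S) + max_twin_clique G X S \<le> colors_used G c"
    proof (rule max_twin_clique_attained[OF fin_digraph_axioms, of X S])
      assume "max_twin_clique G X S = 0"
      moreover have "card (c ` S) \<le> card (c ` verts G)"
        using S X by (intro card_mono) auto
      ultimately show ?thesis
        using ext[OF S] by (simp add: colors_used_def)
    next
      fix C assume C: "C \<in> twin_cliques G X" "neighborhood_in G X C = S"
        "max_twin_clique G X S = card C"
      have sub: "C \<subseteq> verts G"
        using twin_cliques_subset[OF wf_digraph_axioms C(1)] by auto
      have "inj_on c C"
        using twin_clique_adjacent[OF assms(2) C(1)] proper by (meson inj_onI)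
      moreover have "c ` S \<inter> c ` C = {}"
      proof -
        \<comment> \<open>\<open>neighborhood_in\<close> is only a union over \<open>C\<close>; the
          twin property upgrades it, making every vertex of \<open>C\<close> adjacent to every
          vertex of \<open>S\<close>.\<close>
        have "c u \<noteq> c s" if "u \<in> C" "s \<in> S" for u s
          using twin_clique_neighborhood[OF assms(2) C(1) that(1)] C(2) that(2) proper
          by (auto simp: neighborhood_def)
        then show ?thesis by fastforce
      qed
      ultimately have "card (\<phi> ` S) + max_twin_clique G X S = card (c ` S \<union> c ` C)"
        using S X sub C(3) ext[OF S]
          finite_subset[OF S finite_subset[OF X finite_verts]] finite_subset[OF sub finite_verts]
        by (simp add: card_Un_disjoint card_image)
      also have "\<dots> \<le> card (c ` verts G)"
        using S X sub by (intro card_mono) auto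
      finally show ?thesis
        by (simp add: colors_used_def)
    qed
  qed
qed

text \<open>The whole palette is fixed before any twin-clique is colored. Different twin-cliques may
  reuse its colors, which keeps the total within the bound.\<close>

lemma exists_extending_coloring:
  assumes "graph G" "twin_cover G X" "proper_coloring (G \<restriction> X) \<phi>"
  obtains c where "c \<in> extending_colorings G X \<phi>" "colors_used G c \<le> K_bound G X \<phi>"
proof -
  interpret graph G by fact
  let ?H = "delete_verts G X"
  let ?N = "neighborhood_in G X"
  let ?K = "K_bound G X \<phi>"
  interpret H: wf_digraph ?H
    by (rule wf_digraph_delete_verts) (rule wf_digraph_axioms)
  have X: "X \<subseteq> verts G"
    using assms(2) by (simp add: twin_cover_def)
  then have finX: "finite X"
    by (rule finite_subset) simp
  have sym: "v \<rightarrow>\<^bsub>G\<^esub> u" if "u \<rightarrow>\<^bsub>G\<^esub> v" for u v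
    using sym_arcs that by (rule arcs_ends_symmetric)
  have N_sub: "?N C \<subseteq> X" for C
    by (auto simp: neighborhood_in_def)

  \<comment> \<open>The choice \<open>S = X\<close> in the maximum. It ensures that the truncated
    subtraction in the size of \<open>B\<close> below is a true difference.\<close>
  have "card (\<phi> ` X) \<le> ?K"
    using K_bound_upper[OF finX subset_refl, of \<phi> G] by simp
  \<comment> \<open>\<open>B\<close> pads the colors of \<open>X\<close> with fresh ones; they exist
    because the complement of a finite set of naturals is infinite.\<close>
  moreover obtain B where "finite B" "card B = ?K - card (\<phi> ` X)" "B \<subseteq> - \<phi> ` X"
    using infinite_arbitrarily_large[of "- \<phi> ` X" "?K - card (\<phi> ` X)"] finX
    by (auto simp: Compl_eq_Diff_UNIV)
  ultimately obtain P where P: "finite P" "card P = ?K" "\<phi> ` X \<subseteq> P"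
    using finX by (intro that[of "\<phi> ` X \<union> B"]) (auto simp: card_Un_disjoint disjoint_eq_subset_Compl Int_commute)

  \<comment> \<open>Here \<open>S = ?N C\<close> is the relevant term of the maximum: removing the
    colors of \<open>?N C\<close> from \<open>P\<close> leaves at least \<open>card C\<close> of
    them.\<close>
  have "\<exists>f. f ` C \<subseteq> P - \<phi> ` ?N C \<and> inj_on f C" if C: "C \<in> twin_cliques G X" for C
  proof (rule card_le_inj)
    show "finite C"
      using twin_cliques_subset[OF wf_digraph_axioms C] by (auto intro: finite_subset)
    have "card (\<phi> ` ?N C) + card C \<le> ?K"
      using K_bound_upper[OF finX N_sub[of C], where \<phi> = \<phi> and G = G]
        card_twin_clique_le_max_twin_clique[OF fin_digraph_axioms C] by linarith
    moreover have "card (P - \<phi> ` ?N C) = ?K - card (\<phi> ` ?N C)"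
      using P N_sub[of C] finX by (subst card_Diff_subset) (auto intro: finite_subset)
    ultimately show "card C \<le> card (P - \<phi> ` ?N C)"
      by linarith
  qed (use P in simp)
  then obtain f where f: "\<And>C. C \<in> twin_cliques G X \<Longrightarrow> f C ` C \<subseteq> P - \<phi> ` ?N C"
      "\<And>C. C \<in> twin_cliques G X \<Longrightarrow> inj_on (f C) C"
    by metis
  \<comment> \<open>Outside \<open>X\<close>, each vertex uses the injection chosen for its own
    component of \<open>?H\<close>.\<close>
  define c where "c v = (if v \<in> X then \<phi> v else f (H.scc_of v) v)" for v

  have scc: "H.scc_of v \<in> twin_cliques G X" "v \<in> H.scc_of v" if "v \<in> verts G - X" for v
    using that H.scc_of_in_sccs_verts[of v] H.in_scc_of_self[of v] by (simp_all add: twin_cliques_def)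
  have c_in: "c v \<in> P - \<phi> ` ?N (H.scc_of v)" if "v \<in> verts G - X" for v
    using f(1)[OF scc(1)[OF that]] scc(2)[OF that] that by (auto simp: c_def)
  \<comment> \<open>The neighbor \<open>v\<close> belongs to \<open>?N\<close> of the component of
    \<open>u\<close>, whose colors were excluded there. Symmetry of \<open>G\<close> later covers
    the reversed arc.\<close>
  have mixed: "c u \<noteq> c v" if uv: "u \<rightarrow>\<^bsub>G\<^esub> v" "u \<notin> X" "v \<in> X" for u v
  proof -
    have u: "u \<in> verts G - X"
      using uv adj_in_verts by blast
    have "v \<in> ?N (H.scc_of u)"
      using scc(2)[OF u] uv by (auto simp: neighborhood_in_def neighborhood_def)
    then show ?thesis
      using c_in[OF u] uv(3) by (auto simp: c_def)
  qed
  have "c u \<noteq> c v" if uv: "u \<rightarrow>\<^bsub>G\<^esub> v" for u v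
  proof -
    consider "u \<in> X" "v \<in> X" | "u \<in> X" "v \<notin> X" | "u \<notin> X" "v \<in> X" | "u \<notin> X" "v \<notin> X"
      by blast
    then show ?thesis
    proof cases
      case 1
      then have "u \<rightarrow>\<^bsub>G \<restriction> X\<^esub> v"
        using uv by (auto simp: arcs_ends_conv)
      with assms(3) 1 show ?thesis
        by (simp add: proper_coloring_def c_def)
    next
      case 2
      then show ?thesis
        using mixed[OF sym[OF uv]] by simp
    next
      case 3
      then show ?thesis
        using mixed[OF uv] by simp
    next
      case 4
      have v: "v \<in> verts G - X"
        using uv 4 adj_in_verts by blast
      \<comment> \<open>Both directions are recorded because \<open>scc_of\<close> asks for mutual
        reachability. Adjacent vertices outside \<open>X\<close> thus share a component, and one
        injection separates them.\<close>
      have "u \<rightarrow>\<^bsub>?H\<^esub> v" "v \<rightarrow>\<^bsub>?H\<^esub> u"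
        using uv sym[OF uv] 4 by (simp_all add: dominates_delete_verts_iff[OF wf_digraph_axioms])
      then have u: "u \<in> H.scc_of v"
        by (auto simp: H.scc_of_def)
      moreover have "u \<noteq> v"
        using uv adj_not_same by blast
      ultimately have "f (H.scc_of v) u \<noteq> f (H.scc_of v) v"
        using f(2)[OF scc(1)[OF v]] scc(2)[OF v] by (auto dest: inj_onD)
      with 4 H.scc_of_eq[OF u] show ?thesis
        by (simp add: c_def)
    qed
  qed
  then have "c \<in> extending_colorings G X \<phi>"
    by (simp add: extending_colorings_def proper_coloring_def c_def)
  moreover have "c ` verts G \<subseteq> P"
    using c_in P(3) by (fastforce simp: c_def)
  then have "colors_used G c \<le> ?K"
    using card_mono[OF P(1)] P(2) by (simp add: colors_used_def)
  ultimately show thesis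
    by (rule that)
qed

theorem theorem3:
  fixes G :: "('a, 'b) pre_digraph" and X :: "'a set" and \<phi> :: "'a \<Rightarrow> nat"
  assumes "graph G" and "connected G"
    and "twin_cover G X"
    and "proper_coloring (G \<restriction> X) \<phi>"
  shows "is_minimum (K_bound G X \<phi>) (colors_used G ` extending_colorings G X \<phi>)"
proof -
  have lower: "K_bound G X \<phi> \<le> colors_used G c" if "c \<in> extending_colorings G X \<phi>" for c
    using assms(1,3) that by (rule K_bound_le_colors_used)
  obtain c where c: "c \<in> extending_colorings G X \<phi>" "colors_used G c \<le> K_bound G X \<phi>"
    using assms(1,3,4) by (rule exists_extending_coloring)
  \<comment> \<open>The two bounds meet at \<open>c\<close>, so the bound is itself an attained
    number of colors, as a minimum requires.\<close>
  with lower[OF c(1)] have "K_bound G X \<phi> = colors_used G c"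
    by simp
  with c(1) lower show ?thesis
    by (auto simp: is_minimum_def)
qed

end
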